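(* Let $I\subset\mathbb R$ be an interval, let $\mathbf r:I\to\mathbb H_1$ be a smooth horizontally regular curve parametrized by horizontal arc length $s$, with adapted frame $\{\mathbf t,\mathbf n,\mathbf b\}$, $p$-curvature $\kappa$ and contact normality $\tau$. Let $u_1,u_2,u_3:I\to\mathbb R$ be smooth functions and set $$\bar{\mathbf r}(s)=\mathbf r(s)+u_1(s)\mathbf t(s)+u_2(s)\mathbf n(s)+u_3(s)\mathbf b(s).$$ Then $\bar{\mathbf r}$ is constant if and only if on $I$ $$u_1'=\kappa u_2-1,\qquad u_2'=-\kappa u_1,\qquad u_3'=u_2-\tau .$$
   Context: The Heisenberg group $\mathbb H_1$ is identified with $\mathbb R^3$ through its standard coordinates $(x,y,z)$; left translation by $(x,y,z)$ is $(a,b,c)\mapsto(a+x,b+y,c+z+ya-xb)$. The standard left-invariant frame at $(x,y,z)$ is $\mathring{\mathbf e}_1=(1,0,y)$, $\mathring{\mathbf e}_2=(0,1,-x)$, $\mathbf T=(0,0,1)$, and the contact form is $\Theta=dz+x\,dy-y\,dx$. The metric $\langle\cdot,\cdot\rangle$ is the one making $\{\mathring{\mathbf e}_1,\mathring{\mathbf e}_2,\mathbf T\}$ orthonormal. The contact bundle is $\xi=\operatorname{span}\{\mathring{\mathbf e}_1,\mathring{\mathbf e}_2\}$. For a smooth curve $\mathbf r=(x,y,z)$, $\mathbf r'_\xi=x'\mathring{\mathbf e}_1+y'\mathring{\mathbf e}_2$ is the $\xi$-component of the velocity. The curve is horizontally regular if $\mathbf r'_\xi$ never vanishes, i.e.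 $(x')^2+(y')^2\neq0$ everywhere; it is parametrized by horizontal arc length if $(x')^2+(y')^2\equiv1$. For such a parametrization the adapted frame, written in the coordinates of $\mathbb R^3$, is $$\mathbf t=x'\mathring{\mathbf e}_1+y'\mathring{\mathbf e}_2=(x',y',x'y-xy'),\quad \mathbf n=-y'\mathring{\mathbf e}_1+x'\mathring{\mathbf e}_2=(-y',x',-yy'-xx'),\quad \mathbf b=\mathbf T=(0,0,1).$$ The $p$-curvature is $\kappa=\langle\mathbf t',\mathbf n\rangle=x'y''-x''y'$ and the contact normality is $\tau=\Theta(\mathbf r')=xy'-x'y+z'$. Sums of points and adapted-frame vectors, and derivatives of such expressions, are taken componentwise in $\mathbb R^3$ under the identification $\mathbb H_1\simeq\mathbb R^3$. *)

theory Defs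
  imports "HOL-Analysis.Analysis"
begin

text \<open>Derivatives are taken within the parameter interval, hence one-sided at endpoints that
  belong to it. They are determined uniquely only if the interval is nondegenerate.\<close>

abbreviation deriv_on :: "real set \<Rightarrow> (real \<Rightarrow> 'a::real_normed_vector) \<Rightarrow> real \<Rightarrow> 'a" where
  "deriv_on I f \<equiv> \<lambda>s. vector_derivative f (at s within I)"

definition smooth_on :: "real set \<Rightarrow> (real \<Rightarrow> 'a::real_normed_vector) \<Rightarrow> bool" where
  "smooth_on I f \<longleftrightarrow> (\<forall>k. (deriv_on I ^^ k) f differentiable_on I)"

text \<open>Points of the Heisenberg group and tangent vectors at them are both written in the
  standard coordinates of \<^typ>\<open>real^3\<close>.\<close>

type_synonym heis = "real^3"

definition frame1 :: "heis \<Rightarrow> real^3" where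
  "frame1 p = vector [1, 0, p$2]"

definition frame2 :: "heis \<Rightarrow> real^3" where
  "frame2 p = vector [0, 1, - (p$1)]"

definition frameT :: "heis \<Rightarrow> real^3" where
  "frameT p = vector [0, 0, 1]"

definition contact_form :: "heis \<Rightarrow> real^3 \<Rightarrow> real" where
  "contact_form p v = v$3 + p$1 * v$2 - p$2 * v$1"

text \<open>The coefficients of a tangent vector \<open>v\<close> at \<open>p\<close> in the left-invariant frame are
  \<open>v$1\<close>, \<open>v$2\<close> and \<open>contact_form p v\<close>; the metric is the one for which that frame
  is orthonormal.\<close>

definition heis_inner :: "heis \<Rightarrow> real^3 \<Rightarrow> real^3 \<Rightarrow> real" where
  "heis_inner p v w = v$1 * w$1 + v$2 * w$2 + contact_form p v * contact_form p w"

lemma frame_decomposition: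
  "v = v$1 *\<^sub>R frame1 p + v$2 *\<^sub>R frame2 p + contact_form p v *\<^sub>R frameT p"
  by (simp add: vec_eq_iff forall_3 frame1_def frame2_def frameT_def contact_form_def)

lemma bilinear_heis_inner: "bilinear (heis_inner p)"
  by (auto simp: bilinear_def heis_inner_def contact_form_def algebra_simps intro!: linearI)

lemma frame_orthonormal:
  "heis_inner p (frame1 p) (frame1 p) = 1"
  "heis_inner p (frame2 p) (frame2 p) = 1"
  "heis_inner p (frameT p) (frameT p) = 1"
  "heis_inner p (frame1 p) (frame2 p) = 0"
  "heis_inner p (frame1 p) (frameT p) = 0"
  "heis_inner p (frame2 p) (frameT p) = 0"
  by (simp_all add: heis_inner_def contact_form_def frame1_def frame2_def frameT_def)

definition horizontal_velocity :: "real set \<Rightarrow> (real \<Rightarrow> heis) \<Rightarrow> real \<Rightarrow> real^3" where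
  "horizontal_velocity I r s =
     deriv_on I r s $ 1 *\<^sub>R frame1 (r s) + deriv_on I r s $ 2 *\<^sub>R frame2 (r s)"

definition horizontally_regular :: "real set \<Rightarrow> (real \<Rightarrow> heis) \<Rightarrow> bool" where
  "horizontally_regular I r \<longleftrightarrow> (\<forall>s\<in>I. horizontal_velocity I r s \<noteq> 0)"

definition horizontal_arclength_param :: "real set \<Rightarrow> (real \<Rightarrow> heis) \<Rightarrow> bool" where
  "horizontal_arclength_param I r \<longleftrightarrow>
     (\<forall>s\<in>I. (deriv_on I r s $ 1)\<^sup>2 + (deriv_on I r s $ 2)\<^sup>2 = 1)"

text \<open>No normalization by the horizontal speed: this is the adapted frame only for curves
  parametrized by horizontal arc length.\<close>

definition adapted_t :: "real set \<Rightarrow> (real \<Rightarrow> heis) \<Rightarrow> real \<Rightarrow> real^3" where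
  "adapted_t I r s = horizontal_velocity I r s"

definition adapted_n :: "real set \<Rightarrow> (real \<Rightarrow> heis) \<Rightarrow> real \<Rightarrow> real^3" where
  "adapted_n I r s =
     - (deriv_on I r s $ 2) *\<^sub>R frame1 (r s) + deriv_on I r s $ 1 *\<^sub>R frame2 (r s)"

definition adapted_b :: "(real \<Rightarrow> heis) \<Rightarrow> real \<Rightarrow> real^3" where
  "adapted_b r s = frameT (r s)"

text \<open>Here \<open>t'\<close> is the componentwise derivative, regarded as a tangent vector at \<open>r s\<close>.\<close>

definition p_curvature :: "real set \<Rightarrow> (real \<Rightarrow> heis) \<Rightarrow> real \<Rightarrow> real" where
  "p_curvature I r s = heis_inner (r s) (deriv_on I (adapted_t I r) s) (adapted_n I r s)"

definition contact_normality :: "real set \<Rightarrow> (real \<Rightarrow> heis) \<Rightarrow> real \<Rightarrow> real" where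
  "contact_normality I r s = contact_form (r s) (deriv_on I r s)"

lemma adapted_frame_coords:
  "adapted_t I r s = (let x = r s $ 1; y = r s $ 2; x' = deriv_on I r s $ 1; y' = deriv_on I r s $ 2
     in vector [x', y', x' * y - x * y'])"
  "adapted_n I r s = (let x = r s $ 1; y = r s $ 2; x' = deriv_on I r s $ 1; y' = deriv_on I r s $ 2
     in vector [- y', x', - (y * y') - x * x'])"
  "adapted_b r s = vector [0, 0, 1]"
  by (simp_all add: vec_eq_iff forall_3 adapted_t_def horizontal_velocity_def adapted_n_def
      adapted_b_def frame1_def frame2_def frameT_def Let_def)

end

(*
  Write v for the velocity of the curve. Differentiating |(v1, v2)| = 1 gives
  v1 v1' + v2 v2' = 0, hence the Frenet equations v1' = -k v2 and v2' = k v1 with k the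
  p-curvature. Inserted into the componentwise derivative of rbar, they yield
    rbar' = (1 + u1' - k u2) t + (u2' + k u1) n + (u3' + tau - u2) b,
  and since the adapted frame is linearly independent, rbar' vanishes exactly when the three
  coefficients do.
*)
theory Submission
  imports Defs
begin

lemma smooth_on_has_vector_derivative:
  assumes "smooth_on I f" "s \<in> I"
  shows "(f has_vector_derivative deriv_on I f s) (at s within I)"
    and "(deriv_on I f has_vector_derivative deriv_on I (deriv_on I f) s) (at s within I)"
proof -
  have "(deriv_on I ^^ 0) f differentiable_on I" "(deriv_on I ^^ 1) f differentiable_on I"
    using assms(1) unfolding smooth_on_def by blast+
  then show "(f has_vector_derivative deriv_on I f s) (at s within I)"
    and "(deriv_on I f has_vector_derivative deriv_on I (deriv_on I f) s) (at s within I)"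
    using assms(2) by (simp_all add: differentiable_on_def vector_derivative_works)
qed

lemma has_vector_derivative_nth:
  fixes f :: "real \<Rightarrow> real^'n"
  assumes "(f has_vector_derivative f') (at s within I)"
  shows "((\<lambda>s. f s $ i) has_real_derivative f' $ i) (at s within I)"
  using bounded_linear.has_vector_derivative[OF bounded_linear_vec_nth assms]
  by (simp add: has_real_derivative_iff_has_vector_derivative)

text \<open>Reduces derivatives of curves in the coordinates of \<open>real^3\<close> to three
  scalar ones, to which the product rule for reals applies.\<close>

lemma has_vector_derivative_vec3I:
  fixes f :: "real \<Rightarrow> real^3"
  assumes "((\<lambda>s. f s $ 1) has_real_derivative f' $ 1) (at s within I)"
    and "((\<lambda>s. f s $ 2) has_real_derivative f' $ 2) (at s within I)"
    and "((\<lambda>s. f s $ 3) has_real_derivative f' $ 3) (at s within I)"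
  shows "(f has_vector_derivative f') (at s within I)"
proof -
  have *: "((\<lambda>s. f s $ i) has_vector_derivative f' $ i) (at s within I)" for i
    using assms exhaust_3[of i] by (auto simp: has_real_derivative_iff_has_vector_derivative)
  show ?thesis
    unfolding has_vector_derivative_def
    by (subst has_derivative_componentwise_within)
      (use * in \<open>auto simp: Basis_vec_def inner_axis has_vector_derivative_def\<close>)
qed

text \<open>A connected set with more than one point has no isolated points. This makes derivatives
  within \<open>I\<close> unique, also at endpoints belonging to \<open>I\<close>.\<close>

lemma nontrivial_at_within_interval:
  fixes I :: "real set"
  assumes "is_interval I" "interior I \<noteq> {}" "s \<in> I"
  shows "at s within I \<noteq> bot"
proof -
  \<comment> \<open>A singleton has empty interior.\<close>
  have "\<not> I \<subseteq> {s}"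
    using assms(2) interior_mono[of I "{s}"] by auto
  with assms show ?thesis
    using connected_imp_perfect[of I s] is_interval_connected
    by (auto simp: trivial_limit_within)
qed

text \<open>One direction is uniqueness of the derivative within \<open>I\<close>, the other is
  convexity of \<open>I\<close>. The codomain is kept general: the lemma serves both the real-valued
  squared speed and the curve \<open>rbar\<close>.\<close>

lemma constant_on_interval_iff_derivative_zero:
  fixes f :: "real \<Rightarrow> 'a::real_normed_vector"
  assumes "is_interval I" "interior I \<noteq> {}"
    and f: "\<And>s. s \<in> I \<Longrightarrow> (f has_vector_derivative f' s) (at s within I)"
  shows "f constant_on I \<longleftrightarrow> (\<forall>s\<in>I. f' s = 0)"
proof
  assume "f constant_on I"
  then obtain c where c: "\<And>s. s \<in> I \<Longrightarrow> f s = c"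
    by (auto simp: constant_on_def)
  show "\<forall>s\<in>I. f' s = 0"
  proof
    fix s assume s: "s \<in> I"
    have "(f has_vector_derivative 0) (at s within I)"
      by (rule has_vector_derivative_transform[OF s _ has_vector_derivative_const[of c]])
        (simp add: c)
    with f[OF s] show "f' s = 0"
      using vector_derivative_unique_within nontrivial_at_within_interval[OF assms(1,2) s] by blast
  qed
next
  assume "\<forall>s\<in>I. f' s = 0"
  with f have "\<And>s. s \<in> I \<Longrightarrow> (f has_vector_derivative 0) (at s within I)"
    by fastforce
  then show "f constant_on I"
    using has_vector_derivative_zero_constant[of I f] assms(1) is_interval_convex
    by (metis constant_on_def)
qed

lemma adapted_frame_nth:
  "adapted_t I r s $ 1 = deriv_on I r s $ 1"
  "adapted_t I r s $ 2 = deriv_on I r s $ 2"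
  "adapted_t I r s $ 3 = deriv_on I r s $ 1 * r s $ 2 - r s $ 1 * deriv_on I r s $ 2"
  "adapted_n I r s $ 1 = - deriv_on I r s $ 2"
  "adapted_n I r s $ 2 = deriv_on I r s $ 1"
  "adapted_n I r s $ 3 = - (r s $ 2 * deriv_on I r s $ 2) - r s $ 1 * deriv_on I r s $ 1"
  "adapted_b r s $ 1 = 0" "adapted_b r s $ 2 = 0" "adapted_b r s $ 3 = 1"
  by (simp_all add: adapted_frame_coords Let_def)

text \<open>The first two components of t and n form a rotation matrix, of determinant 1 by unit
  horizontal speed, while b contributes only to the third component.\<close>

lemma adapted_frame_independent:
  assumes "horizontal_arclength_param I r" "s \<in> I"
  shows "a *\<^sub>R adapted_t I r s + b *\<^sub>R adapted_n I r s + c *\<^sub>R adapted_b r s = 0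
    \<longleftrightarrow> a = 0 \<and> b = 0 \<and> c = 0"
proof
  let ?x = "deriv_on I r s $ 1" and ?y = "deriv_on I r s $ 2"
  assume *: "a *\<^sub>R adapted_t I r s + b *\<^sub>R adapted_n I r s + c *\<^sub>R adapted_b r s = 0"
  have unit: "?x\<^sup>2 + ?y\<^sup>2 = 1"
    using assms by (simp add: horizontal_arclength_param_def)
  have 1: "a * ?x - b * ?y = 0" and 2: "a * ?y + b * ?x = 0"
    using arg_cong[OF *, of "\<lambda>v. v $ 1"] arg_cong[OF *, of "\<lambda>v. v $ 2"]
    by (simp_all add: adapted_frame_nth)
  \<comment> \<open>Multiplying the equations \<open>1\<close> and \<open>2\<close> by the
    transposed rotation matrix isolates \<open>a\<close> and \<open>b\<close>.\<close>
  have "a = 0" "b = 0"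
    using 1 2 unit by algebra+
  then show "a = 0 \<and> b = 0 \<and> c = 0"
    using arg_cong[OF *, of "\<lambda>v. v $ 3"] by (simp add: adapted_frame_nth)
qed simp

locale arclength_curve =
  fixes I :: "real set" and r :: "real \<Rightarrow> heis"
  assumes interval: "is_interval I" and nondegenerate: "interior I \<noteq> {}"
    and smooth: "smooth_on I r"
    and arclength: "horizontal_arclength_param I r"
begin

abbreviation "v \<equiv> deriv_on I r"
abbreviation "a \<equiv> deriv_on I v"

lemma curve_nth_derivative:
  assumes "s \<in> I"
  shows "((\<lambda>s. r s $ i) has_real_derivative v s $ i) (at s within I)"
    and "((\<lambda>s. v s $ i) has_real_derivative a s $ i) (at s within I)"
  using smooth_on_has_vector_derivative[OF smooth assms] by (auto intro: has_vector_derivative_nth)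

lemma speed_one: "s \<in> I \<Longrightarrow> (v s $ 1)\<^sup>2 + (v s $ 2)\<^sup>2 = 1"
  using arclength by (simp add: horizontal_arclength_param_def)

text \<open>Twice the left-hand side is the derivative of the squared horizontal speed, which is
  constantly 1.\<close>

lemma velocity_orthogonal_acceleration:
  assumes "s \<in> I"
  shows "v s $ 1 * a s $ 1 + v s $ 2 * a s $ 2 = 0"
proof -
  let ?f = "\<lambda>s. (v s $ 1)\<^sup>2 + (v s $ 2)\<^sup>2"
  have "(?f has_real_derivative 2 * (v s $ 1 * a s $ 1 + v s $ 2 * a s $ 2)) (at s within I)"
    if "s \<in> I" for s
    using that
    by (auto intro!: derivative_eq_intros curve_nth_derivative simp: algebra_simps)
  moreover have "?f constant_on I"
    using speed_one by (auto simp: constant_on_def)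
  ultimately have "\<forall>s\<in>I. 2 * (v s $ 1 * a s $ 1 + v s $ 2 * a s $ 2) = 0"
    unfolding has_real_derivative_iff_has_vector_derivative
    using constant_on_interval_iff_derivative_zero[OF interval nondegenerate, of ?f
        "\<lambda>s. 2 * (v s $ 1 * a s $ 1 + v s $ 2 * a s $ 2)"]
    by blast
  with assms have "2 * (v s $ 1 * a s $ 1 + v s $ 2 * a s $ 2) = 0"
    by blast
  then show ?thesis
    by (simp only: mult_eq_0_iff zero_neq_numeral[symmetric] simp_thms)
qed

text \<open>In the third component the two products of first derivatives cancel, so t' is again
  horizontal at \<open>r s\<close>.\<close>

lemma adapted_t_derivative:
  assumes "s \<in> I"
  shows "deriv_on I (adapted_t I r) s = vector [a s $ 1, a s $ 2, a s $ 1 * r s $ 2 - r s $ 1 * a s $ 2]"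
    (is "_ = ?t'")
proof -
  have "(adapted_t I r has_vector_derivative ?t') (at s within I)"
    by (rule has_vector_derivative_vec3I)
      (use assms in \<open>auto simp: adapted_frame_nth intro!: derivative_eq_intros curve_nth_derivative\<close>)
  then show ?thesis
    by (rule vector_derivative_within[OF nontrivial_at_within_interval[OF interval nondegenerate assms]])
qed

text \<open>The contact form vanishes on both t' and n, so only the first two components enter the
  inner product.\<close>

lemma p_curvature_eq:
  assumes "s \<in> I"
  shows "p_curvature I r s = v s $ 1 * a s $ 2 - a s $ 1 * v s $ 2"
  unfolding p_curvature_def heis_inner_def contact_form_def adapted_t_derivative[OF assms]
  by (simp add: adapted_frame_nth algebra_simps)

text \<open>The planar acceleration is orthogonal to the unit vector (\<open>v s $ 1\<close>,
  \<open>v s $ 2\<close>), hence a multiple of its rotation by a right angle; the factor is the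
  p-curvature.\<close>

lemma frenet:
  assumes "s \<in> I"
  shows "a s $ 1 = - p_curvature I r s * v s $ 2" "a s $ 2 = p_curvature I r s * v s $ 1"
  unfolding p_curvature_eq[OF assms]
  using speed_one[OF assms] velocity_orthogonal_acceleration[OF assms] by algebra+

text \<open>With k the p-curvature and tau the contact normality, this combines r' = t + tau b, t' =
  k n, n' = -k t - b and b' = 0 by the product rule.\<close>

lemma adapted_combination_derivative:
  assumes s: "s \<in> I"
    and u1: "(u1 has_real_derivative u1') (at s within I)"
    and u2: "(u2 has_real_derivative u2') (at s within I)"
    and u3: "(u3 has_real_derivative u3') (at s within I)"
  shows "((\<lambda>s. r s + u1 s *\<^sub>R adapted_t I r s + u2 s *\<^sub>R adapted_n I r s + u3 s *\<^sub>R adapted_b r s)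
      has_vector_derivative
        (1 + u1' - p_curvature I r s * u2 s) *\<^sub>R adapted_t I r s
        + (u2' + p_curvature I r s * u1 s) *\<^sub>R adapted_n I r s
        + (u3' + contact_normality I r s - u2 s) *\<^sub>R adapted_b r s) (at s within I)"
proof -
  note deriv = curve_nth_derivative[OF s] u1 u2 u3
  note coords = vector_add_component vector_scaleR_component real_scaleR_def adapted_frame_nth
    contact_normality_def contact_form_def
  show ?thesis
  proof ((rule has_vector_derivative_vec3I; unfold coords), goal_cases)
    case 1
    show ?case
      \<comment> \<open>\<open>DERIV_cong\<close> leaves the derivative open for the rules to build;
        what remains is its equality with the claimed component.\<close>
      by (rule DERIV_cong, (rule deriv DERIV_add DERIV_diff DERIV_mult DERIV_minus DERIV_const)+)
        (simp add: frenet[OF s] algebra_simps)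
  next
    case 2
    show ?case
      by (rule DERIV_cong, (rule deriv DERIV_add DERIV_diff DERIV_mult DERIV_minus DERIV_const)+)
        (simp add: frenet[OF s] algebra_simps)
  next
    case 3
    show ?case
      by (rule DERIV_cong, (rule deriv DERIV_add DERIV_diff DERIV_mult DERIV_minus DERIV_const)+)
        \<comment> \<open>Differentiating the third component of n produces minus the squared
          horizontal speed. Unit speed turns it into -1, the source of the term
          \<open>- u2 s\<close> in the coefficient of b.\<close>
        (simp only: frenet[OF s], use speed_one[OF s] in algebra)
  qed
qed

end

theorem mainTheorem1:
  fixes I :: "real set"
    and r rbar :: "real \<Rightarrow> heis"
    and u1 u2 u3 :: "real \<Rightarrow> real"
  assumes "is_interval I" and "interior I \<noteq> {}"
    and "smooth_on I r"
    and "horizontally_regular I r"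
    and "horizontal_arclength_param I r"
    and "smooth_on I u1" and "smooth_on I u2" and "smooth_on I u3"
    and "\<And>s. s \<in> I \<Longrightarrow>
           rbar s = r s + u1 s *\<^sub>R adapted_t I r s + u2 s *\<^sub>R adapted_n I r s
                        + u3 s *\<^sub>R adapted_b r s"
  shows "rbar constant_on I \<longleftrightarrow>
    (\<forall>s\<in>I. deriv_on I u1 s = p_curvature I r s * u2 s - 1
          \<and> deriv_on I u2 s = - p_curvature I r s * u1 s
          \<and> deriv_on I u3 s = u2 s - contact_normality I r s)"
proof -
  interpret arclength_curve I r
    using assms by unfold_locales
  let ?D = "\<lambda>s. (1 + deriv_on I u1 s - p_curvature I r s * u2 s) *\<^sub>R adapted_t I r s
        + (deriv_on I u2 s + p_curvature I r s * u1 s) *\<^sub>R adapted_n I r s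
        + (deriv_on I u3 s + contact_normality I r s - u2 s) *\<^sub>R adapted_b r s"
  have "(rbar has_vector_derivative ?D s) (at s within I)" if s: "s \<in> I" for s
    using adapted_combination_derivative[OF s,
        unfolded has_real_derivative_iff_has_vector_derivative,
        OF assms(6-8)[THEN smooth_on_has_vector_derivative(1), OF s]]
    \<comment> \<open>The formula for \<open>rbar\<close> is given on \<open>I\<close> only, which
      suffices for derivatives within \<open>I\<close>.\<close>
    by (rule has_vector_derivative_transform[OF s, rotated]) (simp add: assms(9))
  then have "rbar constant_on I \<longleftrightarrow> (\<forall>s\<in>I. ?D s = 0)"
    by (rule constant_on_interval_iff_derivative_zero[OF assms(1,2)])
  also have "\<dots> \<longleftrightarrow> (\<forall>s\<in>I. deriv_on I u1 s = p_curvature I r s * u2 s - 1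
          \<and> deriv_on I u2 s = - p_curvature I r s * u1 s
          \<and> deriv_on I u3 s = u2 s - contact_normality I r s)"
    by (intro ball_cong refl) (auto simp: adapted_frame_independent[OF assms(5)])
  finally show ?thesis .
qed

end
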